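(* Assume that for every $y\in\mathcal Y$ the function $f(\cdot,y)$ is convex on $\mathcal X$ (no concavity of $f(x,\cdot)$ is assumed) and that $f$ satisfies the Lipschitz gradient assumption with constants $L_{11},L_{12},L_{21},L_{22}>0$. Let $\{q_k\}_{k\ge1}$ be a nonnegative monotonically decreasing sequence, let $\bar\zeta,\bar\nu>0$ be constants, $\{\bar\gamma_k\}_{k\ge1}$ real numbers, and let $\{(x_k,y_k)\}_{k\ge1}$ be generated from $(x_1,y_1)\in\mathcal X\times\mathcal Y$ by $$x_{k+1}=\mathcal P_{\mathcal X}\big(x_k-\bar\zeta\nabla_xf(x_k,y_k)-\bar\zeta q_kx_k\big),\qquad y_{k+1}=\mathcal P_{\mathcal Y}\Big(y_k+\tfrac1{\bar\nu+\bar\gamma_k}\nabla_yf(x_{k+1},y_k)\Big),\quad k\ge1.$$ Put $L_{11}'=L_{11}+q_1$. If $\bar\gamma_k>L_{22}$ for all $k$ and $\bar\zeta\le\frac2{L_{11}'+q_1}$, then for all $k\ge2$, $$f(x_{k+1},y_{k+1})-f(x_k,y_k)\ge\Big(\bar\nu+\frac{\bar\gamma_k}{2}\Big)\|y_{k+1}-y_k\|^2-\frac{L_{21}^2\bar\zeta}{2}\|y_k-y_{k-1}\|^2-\frac1{\bar\zeta}\|x_{k+1}-x_k\|^2-\frac1{2\bar\zeta}\|x_k-x_{k-1}\|^2-\frac{q_{k-1}}{2}\big(\|x_{k+1}\|^2-\|x_k\|^2\big).$$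
   Context: $\mathcal X\subseteq\mathbb R^n$ and $\mathcal Y\subseteq\mathbb R^m$ are nonempty closed bounded convex sets and $f:\mathcal X\times\mathcal Y\to\mathbb R$ is a smooth function. $\|\cdot\|$ is the Euclidean norm; $\mathcal P_{\mathcal X},\mathcal P_{\mathcal Y}$ are Euclidean projections. Lipschitz gradient assumption: for all $x,\bar x\in\mathcal X$, $y,\bar y\in\mathcal Y$: $\|\nabla_xf(x,y)-\nabla_xf(\bar x,y)\|\le L_{11}\|x-\bar x\|$, $\|\nabla_xf(x,y)-\nabla_xf(x,\bar y)\|\le L_{21}\|y-\bar y\|$, $\|\nabla_yf(x,y)-\nabla_yf(x,\bar y)\|\le L_{22}\|y-\bar y\|$, $\|\nabla_yf(x,y)-\nabla_yf(\bar x,y)\|\le L_{12}\|x-\bar x\|$. *)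

theory Defs
  imports "HOL-Analysis.Analysis"
begin

text \<open>
  A function on a set that need not be open is called smooth here if it is differentiable
  relative to that set and has a continuous gradient \<open>g\<close>.  The restriction to \<open>S\<close> of every
  function that is continuously differentiable on an open neighbourhood of \<open>S\<close> is smooth in this
  sense, \<open>g\<close> being its ordinary gradient.  For convex \<open>S\<close> with nonempty interior \<open>g\<close> is determined
  on \<open>S\<close> by \<open>f\<close>; otherwise it is one choice of gradient, so \<open>g\<close> is a parameter of the predicate.
\<close>

definition smooth_with_gradient ::
    "('a::real_inner \<Rightarrow> real) \<Rightarrow> ('a \<Rightarrow> 'a) \<Rightarrow> 'a set \<Rightarrow> bool" where
  "smooth_with_gradient f g S \<longleftrightarrow>
     (\<forall>z\<in>S. (f has_derivative (\<lambda>h. inner h (g z))) (at z within S)) \<and> continuous_on S g"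

definition smooth_with_partial_gradients ::
    "('a::real_inner \<times> 'b::real_inner \<Rightarrow> real) \<Rightarrow> ('a \<times> 'b \<Rightarrow> 'a) \<Rightarrow> ('a \<times> 'b \<Rightarrow> 'b) \<Rightarrow>
     'a set \<Rightarrow> 'b set \<Rightarrow> bool" where
  "smooth_with_partial_gradients f gx gy X Y \<longleftrightarrow>
     smooth_with_gradient f (\<lambda>z. (gx z, gy z)) (X \<times> Y)"

text \<open>
  In \<open>L12\<close> and \<open>L21\<close> the first index is the variable that is moved and the second the
  differentiation variable, 1 standing for \<open>x\<close> and 2 for \<open>y\<close>.
\<close>

definition lipschitz_gradients ::
    "('a::real_normed_vector \<times> 'b::real_normed_vector \<Rightarrow> 'a) \<Rightarrow> ('a \<times> 'b \<Rightarrow> 'b) \<Rightarrow>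
     'a set \<Rightarrow> 'b set \<Rightarrow> real \<Rightarrow> real \<Rightarrow> real \<Rightarrow> real \<Rightarrow> bool" where
  "lipschitz_gradients gx gy X Y L11 L12 L21 L22 \<longleftrightarrow>
     (\<forall>x\<in>X. \<forall>x'\<in>X. \<forall>y\<in>Y. \<forall>y'\<in>Y.
        norm (gx (x, y) - gx (x', y)) \<le> L11 * norm (x - x') \<and>
        norm (gx (x, y) - gx (x, y')) \<le> L21 * norm (y - y') \<and>
        norm (gy (x, y) - gy (x, y')) \<le> L22 * norm (y - y') \<and>
        norm (gy (x, y) - gy (x', y)) \<le> L12 * norm (x - x'))"

end

theory Submission
  imports Defs
begin

text \<open>
  Write \<open>d\<close> and \<open>e\<close> for the two consecutive increments \<open>x (k + 1) - x k\<close> and \<open>x k - x (k - 1)\<close>.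
  Ascent in \<open>y\<close> follows from the descent lemma and the variational inequality of the projection.
  For \<open>x\<close>, convexity bounds the increment of \<open>f\<close> below by \<open>inner (gx (x k, y k)) d\<close>, which is
  compared with the variational inequality of the previous projection, tested at \<open>x (k + 1)\<close>.
  The change of \<open>gx\<close> in \<open>y\<close> is absorbed by Young's inequality.  The change in \<open>x\<close> is usually
  treated by cocoercivity, which is not directly available on a convex set; what is needed is only
  the lower bound \<open>- L11 / 4 * (norm (d - e))\<^sup>2\<close> for its inner product with \<open>d\<close>, and this can be
  proved inside the triangle spanned by the three iterates.
\<close>

section \<open>First-order inequalities on a convex set, by restriction to segments\<close>

lemma smooth_with_gradient_along_segment:
  fixes F :: "'a::real_inner \<Rightarrow> real"
  assumes F: "smooth_with_gradient F g S" and S: "convex S"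
    and a: "a \<in> S" and b: "b \<in> S" and r: "r \<in> {0..1}"
  shows "((\<lambda>r. F (a + r *\<^sub>R (b - a))) has_derivative
    (\<lambda>h. h * inner (b - a) (g (a + r *\<^sub>R (b - a))))) (at r within {0..1})"
proof -
  have mem: "a + r *\<^sub>R (b - a) \<in> S" if "r \<in> {0..1}" for r
    using convexD_alt[OF S a b, of r] that by (simp add: algebra_simps)
  have "(F has_derivative (\<lambda>h. inner h (g (a + r *\<^sub>R (b - a))))) (at (a + r *\<^sub>R (b - a)) within S)"
    using F mem[OF r] by (simp add: smooth_with_gradient_def)
  moreover have "((\<lambda>r. a + r *\<^sub>R (b - a)) has_derivative (\<lambda>h. h *\<^sub>R (b - a))) (at r within {0..1})"
    by (auto intro!: derivative_eq_intros)
  ultimately have "(F \<circ> (\<lambda>r. a + r *\<^sub>R (b - a)) has_derivative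
      (\<lambda>h. inner h (g (a + r *\<^sub>R (b - a)))) \<circ> (\<lambda>h. h *\<^sub>R (b - a))) (at r within {0..1})"
    using mem by (intro diff_chain_within) (auto elim: has_derivative_subset)
  then show ?thesis
    by (simp add: o_def)
qed

text \<open>Convexity bounds the difference quotients at \<open>a\<close> along the segment by
  \<open>F b - F a\<close>; their one-sided limit is the directional derivative.\<close>

lemma convex_above_tangent:
  fixes F :: "'a::real_inner \<Rightarrow> real"
  assumes F: "smooth_with_gradient F g S" and cvx: "convex_on S F"
    and a: "a \<in> S" and b: "b \<in> S"
  shows "F b \<ge> F a + inner (g a) (b - a)"
proof -
  let ?\<phi> = "\<lambda>r. F (a + r *\<^sub>R (b - a))"
  have S: "convex S"
    using cvx by (simp add: convex_on_def)
  have "(?\<phi> has_field_derivative inner (b - a) (g a)) (at 0 within {0..1})"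
    using smooth_with_gradient_along_segment[OF F S a b, of 0]
    by (simp add: has_field_derivative_def mult_commute_abs)
  then have "((\<lambda>r. (?\<phi> r - F a) / r) \<longlongrightarrow> inner (b - a) (g a)) (at 0 within {0..1})"
    by (simp add: has_field_derivative_iff)
  moreover have "\<forall>\<^sub>F r in at 0 within {0..1}. (?\<phi> r - F a) / r \<le> F b - F a"
    unfolding eventually_at_filter
  proof (intro always_eventually allI impI)
    fix r :: real
    assume "r \<noteq> 0" "r \<in> {0..1}"
    then have "?\<phi> r - F a \<le> (F b - F a) * r" and "0 < r"
      using convex_onD[OF cvx, of r a b] a b by (simp_all add: algebra_simps)
    then show "(?\<phi> r - F a) / r \<le> F b - F a"
      by (simp only: pos_divide_le_eq)
  qed
  moreover have "at (0::real) within {0..1} \<noteq> bot"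
    by (simp add: trivial_limit_within islimpt_Icc)
  ultimately have "inner (b - a) (g a) \<le> F b - F a"
    by (intro tendsto_upperbound)
  then show ?thesis
    by (simp add: inner_commute)
qed

text \<open>The mean value theorem, applied to the excess \<open>?\<psi>\<close> of \<open>F\<close>
  over the claimed quadratic bound along the segment, replaces integration of the gradient: the
  Lipschitz condition makes the derivative of \<open>?\<psi>\<close> nonpositive.\<close>

lemma descent_upper:
  fixes F :: "'a::real_inner \<Rightarrow> real"
  assumes F: "smooth_with_gradient F g S" and S: "convex S"
    and lip: "L-lipschitz_on S g" and a: "a \<in> S" and b: "b \<in> S"
  shows "F b \<le> F a + inner (g a) (b - a) + L / 2 * (norm (b - a))\<^sup>2"
proof -
  let ?p = "\<lambda>r. a + r *\<^sub>R (b - a)"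
  let ?\<psi> = "\<lambda>r. F (?p r) - r * inner (g a) (b - a) - L / 2 * r\<^sup>2 * (norm (b - a))\<^sup>2"
  have "(?\<psi> has_derivative (\<lambda>h. h * inner (b - a) (g (?p r)) - h * inner (g a) (b - a)
      - L * (h * r) * (norm (b - a))\<^sup>2)) (at r within {0..1})" if "r \<in> {0..1}" for r
    by (rule derivative_eq_intros smooth_with_gradient_along_segment[OF F S a b that] refl)+
      (simp add: power2_eq_square)
  then obtain r where r: "r \<in> {0<..<1}"
    and eq: "?\<psi> 1 - ?\<psi> 0 = (1 - 0) * inner (b - a) (g (?p r)) - (1 - 0) * inner (g a) (b - a)
      - L * ((1 - 0) * r) * (norm (b - a))\<^sup>2"
    using mvt_simple[of 0 1 ?\<psi> "\<lambda>r h. h * inner (b - a) (g (?p r)) - h * inner (g a) (b - a)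
      - L * (h * r) * (norm (b - a))\<^sup>2"] by auto
  have "?p r \<in> S"
    using convexD_alt[OF S a b, of r] r by (simp add: algebra_simps)
  then have "norm (g (?p r) - g a) \<le> L * (r * norm (b - a))"
    using lipschitz_onD[OF lip _ a, of "?p r"] r by (simp add: dist_norm)
  then have "norm (b - a) * norm (g (?p r) - g a) \<le> norm (b - a) * (L * (r * norm (b - a)))"
    by (intro mult_left_mono) auto
  then have "inner (b - a) (g (?p r) - g a) \<le> L * r * (norm (b - a))\<^sup>2"
    using norm_cauchy_schwarz[of "b - a" "g (?p r) - g a"]
    by (simp add: power2_eq_square mult_ac)
  with eq show ?thesis
    by (simp add: inner_diff_right inner_commute)
qed

lemma descent_lower:
  fixes F :: "'a::real_inner \<Rightarrow> real"
  assumes F: "smooth_with_gradient F g S" and S: "convex S"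
    and lip: "L-lipschitz_on S g" and a: "a \<in> S" and b: "b \<in> S"
  shows "F b \<ge> F a + inner (g a) (b - a) - L / 2 * (norm (b - a))\<^sup>2"
proof -
  have "smooth_with_gradient (\<lambda>z. - F z) (\<lambda>z. - g z) S"
    using F by (auto simp: smooth_with_gradient_def intro!: derivative_eq_intros continuous_intros)
  moreover have "L-lipschitz_on S (\<lambda>z. - g z)"
    using lip by simp
  ultimately show ?thesis
    using descent_upper[of "\<lambda>z. - F z" "\<lambda>z. - g z" S L a b] S a b by simp
qed

section \<open>Gradient differences of a convex function at three points\<close>

text \<open>
  Compare the tangent at one end of the segment with the descent bound at the other end displaced
  by \<open>w\<close>, once for each end, and add up.
\<close>

lemma gradient_difference_displaced:
  fixes F :: "'a::real_inner \<Rightarrow> real"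
  assumes F: "smooth_with_gradient F g S" and cvx: "convex_on S F" and lip: "L-lipschitz_on S g"
    and a: "a \<in> S" and b: "b \<in> S" and aw: "a - w \<in> S" and bw: "b + w \<in> S"
  shows "inner (g b - g a) (b - a + 2 *\<^sub>R w) \<ge> - L * (norm w)\<^sup>2"
proof -
  have S: "convex S"
    using cvx by (simp add: convex_on_def)
  show ?thesis
    using descent_upper[OF F S lip b bw] convex_above_tangent[OF F cvx a bw]
      descent_upper[OF F S lip a aw] convex_above_tangent[OF F cvx b aw]
    by (simp add: inner_diff_left inner_diff_right inner_add_right)
qed

text \<open>
  Subdividing \<open>[a, b]\<close> into \<open>N\<close> pieces shrinks the room that is needed around the segment to
  \<open>w / N\<close>.
\<close>

lemma gradient_difference_subdivided:
  fixes F :: "'a::real_inner \<Rightarrow> real"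
  assumes F: "smooth_with_gradient F g S" and cvx: "convex_on S F" and lip: "L-lipschitz_on S g"
    and N: "N > 0"
    and plus: "\<And>r. r \<in> {0..1} \<Longrightarrow> a + r *\<^sub>R (b - a) + (1 / real N) *\<^sub>R w \<in> S"
    and minus: "\<And>r. r \<in> {0..1} \<Longrightarrow> a + r *\<^sub>R (b - a) - (1 / real N) *\<^sub>R w \<in> S"
  shows "inner (g b - g a) (b - a + 2 *\<^sub>R w) \<ge> - L * (norm w)\<^sup>2"
proof -
  have S: "convex S"
    using cvx by (simp add: convex_on_def)
  define p where "p i = a + (real i / real N) *\<^sub>R (b - a)" for i
  have diff: "p (Suc i) - p i = (1 / real N) *\<^sub>R (b - a)" for i
    by (simp add: p_def add_divide_distrib algebra_simps)
  have p_plus: "p i + (1 / real N) *\<^sub>R w \<in> S" and p_minus: "p i - (1 / real N) *\<^sub>R w \<in> S"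
    if "i \<le> N" for i
    using plus[of "real i / real N"] minus[of "real i / real N"] that N by (auto simp: p_def)
  \<comment> \<open>\<open>p i\<close> is the midpoint of its two displacements.\<close>
  have p: "p i \<in> S" if "i \<le> N" for i
    using convexD_alt[OF S p_plus p_minus, of i i "1/2"] that
    by (simp add: algebra_simps flip: scaleR_add_left)
  \<comment> \<open>Subdivision loses nothing: each piece has an error of order
    \<open>1 / N^2\<close>, one factor \<open>1 / N\<close> cancels against the scaled direction,
    and the \<open>N\<close> remaining errors add up to the original one.\<close>
  have step: "inner (g (p (Suc i)) - g (p i)) (b - a + 2 *\<^sub>R w) \<ge> - L / real N * (norm w)\<^sup>2"
    if "i < N" for i
  proof -
    have "- L * (norm ((1 / real N) *\<^sub>R w))\<^sup>2 \<le>
        inner (g (p (Suc i)) - g (p i)) (p (Suc i) - p i + 2 *\<^sub>R ((1 / real N) *\<^sub>R w))"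
      using that by (intro gradient_difference_displaced[OF F cvx lip] p p_plus p_minus) auto
    also have "p (Suc i) - p i + 2 *\<^sub>R ((1 / real N) *\<^sub>R w) = (1 / real N) *\<^sub>R (b - a + 2 *\<^sub>R w)"
      by (simp add: diff algebra_simps)
    finally have "- L * (norm w)\<^sup>2 / real N / real N \<le>
        inner (g (p (Suc i)) - g (p i)) (b - a + 2 *\<^sub>R w) / real N"
      unfolding inner_scaleR_right by (simp add: power_divide power2_eq_square)
    with N show ?thesis
      by (subst (asm) divide_le_cancel) simp
  qed
  have "- L * (norm w)\<^sup>2 = (\<Sum>i<N. - L / real N * (norm w)\<^sup>2)"
    using N by simp
  also have "\<dots> \<le> (\<Sum>i<N. inner (g (p (Suc i)) - g (p i)) (b - a + 2 *\<^sub>R w))"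
    by (intro sum_mono step) auto
  also have "\<dots> = inner (g (p N) - g (p 0)) (b - a + 2 *\<^sub>R w)"
    by (simp only: sum_lessThan_telescope[of "\<lambda>i. g (p i)"] flip: inner_sum_left)
  finally show ?thesis
    using N by (simp add: p_def)
qed

text \<open>
  On the whole space this follows from cocoercivity of the gradient.  On a convex set there is a
  priori no room around \<open>a\<close> and \<open>b\<close>; it is created by contracting the triangle \<open>a b c\<close> towards its
  centroid \<open>z\<close> by \<open>3 / N\<close>.
\<close>

lemma gradient_difference_three_points:
  fixes F :: "'a::real_inner \<Rightarrow> real"
  assumes F: "smooth_with_gradient F g S" and cvx: "convex_on S F" and lip: "L-lipschitz_on S g"
    and a: "a \<in> S" and b: "b \<in> S" and c: "c \<in> S"
  shows "inner (g b - g a) (c - b) \<ge> - L / 4 * (norm (c - b - (b - a)))\<^sup>2"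
proof -
  have S: "convex S"
    using cvx by (simp add: convex_on_def)
  define z where "z = (1/3) *\<^sub>R (a + b + c)"
  \<comment> \<open>Half the second difference of \<open>a\<close>, \<open>b\<close>,
    \<open>c\<close>: then \<open>b - a + 2 *\<^sub>R w\<close> is \<open>c - b\<close>, and the
    half, squared, yields the constant \<open>1 / 4\<close>.\<close>
  define w where "w = (1/2) *\<^sub>R (a + c) - b"
  have comb: "\<alpha> *\<^sub>R a + \<beta> *\<^sub>R b + \<delta> *\<^sub>R c \<in> S"
    if "\<alpha> \<ge> 0" "\<beta> \<ge> 0" "\<delta> \<ge> 0" "\<alpha> + \<beta> + \<delta> = 1" for \<alpha> \<beta> \<delta>
  proof -
    have "\<alpha> *\<^sub>R a + \<beta> *\<^sub>R b + \<delta> *\<^sub>R c \<in> convex hull {a, b, c}"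
      using that by (auto simp: convex_hull_3)
    also have "convex hull {a, b, c} \<subseteq> S"
      using S a b c by (intro hull_minimal) auto
    finally show ?thesis .
  qed
  define A where "A N = a + (3 / real N) *\<^sub>R (z - a)" for N
  define B where "B N = b + (3 / real N) *\<^sub>R (z - b)" for N
  have mem: "A N + r *\<^sub>R (B N - A N) + s *\<^sub>R w \<in> S"
    if N: "N \<ge> 3" and r: "r \<in> {0..1}" and s: "\<bar>s\<bar> \<le> 1 / real N" for N r s
  proof -
    define e where "e = 1 / real N"
    have e: "3 / real N = 3 * e" "0 \<le> e" "3 * e \<le> 1" "\<bar>s\<bar> \<le> e"
      using N s by (simp_all add: e_def)
    \<comment> \<open>Contraction by \<open>3 * e\<close> gives every vertex weight at least
      \<open>e\<close>, whereas adding \<open>s *\<^sub>R w\<close> changes the weights by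
      \<open>s / 2\<close>, \<open>- s\<close>, \<open>s / 2\<close>. Testing against an arbitrary
      vector reduces the identity to real arithmetic.\<close>
    have "A N + r *\<^sub>R (B N - A N) + s *\<^sub>R w =
        ((1 - 3 * e) * (1 - r) + (e + s / 2)) *\<^sub>R a
        + ((1 - 3 * e) * r + (e - s)) *\<^sub>R b + (e + s / 2) *\<^sub>R c"
      by (rule iffD1[OF vector_eq_ldot])
        (auto simp: A_def B_def z_def w_def e(1) inner_add_right inner_diff_right field_simps)
    moreover have "0 \<le> (1 - 3 * e) * (1 - r)" "0 \<le> (1 - 3 * e) * r"
      using e r by auto
    moreover have "0 \<le> e + s / 2" "0 \<le> e - s"
      using e by auto
    moreover have "(1 - 3 * e) * (1 - r) + (e + s / 2) + ((1 - 3 * e) * r + (e - s)) + (e + s / 2) = 1"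
      by (simp add: algebra_simps)
    ultimately show ?thesis
      using comb by simp
  qed
  have A: "A N \<in> S" and B: "B N \<in> S" if "N \<ge> 3" for N
    using mem[OF that, of 0 0] mem[OF that, of 1 0] by auto
  have "((\<lambda>N. 3 / real N) \<longlongrightarrow> 0) sequentially"
    by (rule lim_const_over_n)
  then have "A \<longlonglongrightarrow> a + 0 *\<^sub>R (z - a)" and "B \<longlonglongrightarrow> b + 0 *\<^sub>R (z - b)"
    unfolding A_def B_def by (intro tendsto_intros; assumption)+
  then have lim: "A \<longlonglongrightarrow> a" "B \<longlonglongrightarrow> b"
    by simp_all
  have "\<forall>\<^sub>F N in sequentially. A N \<in> S" "\<forall>\<^sub>F N in sequentially. B N \<in> S"
    using A B by (auto simp: eventually_sequentially)
  then have "(\<lambda>N. g (A N)) \<longlonglongrightarrow> g a" "(\<lambda>N. g (B N)) \<longlonglongrightarrow> g b"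
    using lipschitz_on_continuous_on[OF lip] lim a b
    by (auto intro: continuous_on_tendsto_compose)
  with lim have "(\<lambda>N. inner (g (B N) - g (A N)) (B N - A N + 2 *\<^sub>R w))
      \<longlonglongrightarrow> inner (g b - g a) (b - a + 2 *\<^sub>R w)"
    by (intro tendsto_intros)
  \<comment> \<open>Only the room needed shrinks with \<open>N\<close>; the bound itself does not
    depend on \<open>N\<close> and so survives the limit.\<close>
  moreover have "inner (g (B N) - g (A N)) (B N - A N + 2 *\<^sub>R w) \<ge> - L * (norm w)\<^sup>2"
    if "N \<ge> 3" for N
    using that mem[OF that, of _ "1 / real N"] mem[OF that, of _ "- (1 / real N)"]
    by (intro gradient_difference_subdivided[OF F cvx lip, of N]) auto
  ultimately have "- L * (norm w)\<^sup>2 \<le> inner (g b - g a) (b - a + 2 *\<^sub>R w)"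
    by (intro tendsto_lowerbound[of _ _ sequentially]) (auto simp: eventually_sequentially)
  moreover have "b - a + 2 *\<^sub>R w = c - b"
    by (simp add: w_def algebra_simps scaleR_2)
  moreover have "c - b - (b - a) = 2 *\<^sub>R w"
    by (simp add: w_def algebra_simps scaleR_2)
  ultimately show ?thesis
    by (simp add: power_mult_distrib)
qed

section \<open>Partial gradients on slices of a product\<close>

lemma smooth_with_partial_gradients_fst:
  assumes f: "smooth_with_partial_gradients f gx gy X Y" and v: "v \<in> Y"
  shows "smooth_with_gradient (\<lambda>u. f (u, v)) (\<lambda>u. gx (u, v)) X"
  unfolding smooth_with_gradient_def
proof (intro conjI ballI)
  fix u
  assume "u \<in> X"
  then have "(f has_derivative (\<lambda>h. inner h (gx (u, v), gy (u, v)))) (at (u, v) within X \<times> Y)"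
    using f v by (simp add: smooth_with_partial_gradients_def smooth_with_gradient_def)
  then have "(f \<circ> (\<lambda>u. (u, v)) has_derivative
      (\<lambda>h. inner h (gx (u, v), gy (u, v))) \<circ> (\<lambda>h. (h, 0))) (at u within X)"
    using v by (intro diff_chain_within)
      (auto intro!: has_derivative_Pair has_derivative_ident has_derivative_const
        elim: has_derivative_subset)
  then show "((\<lambda>u. f (u, v)) has_derivative (\<lambda>h. inner h (gx (u, v)))) (at u within X)"
    by (simp add: o_def inner_Pair)
next
  have "continuous_on (X \<times> Y) (\<lambda>z. fst (gx z, gy z))"
    using f unfolding smooth_with_partial_gradients_def smooth_with_gradient_def
    by (intro continuous_on_fst) auto
  then show "continuous_on X (\<lambda>u. gx (u, v))"
    using v by (intro continuous_on_compose2[of "X \<times> Y" gx X "\<lambda>u. (u, v)"])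
      (auto intro!: continuous_intros)
qed

lemma smooth_with_partial_gradients_snd:
  assumes f: "smooth_with_partial_gradients f gx gy X Y" and u: "u \<in> X"
  shows "smooth_with_gradient (\<lambda>v. f (u, v)) (\<lambda>v. gy (u, v)) Y"
  unfolding smooth_with_gradient_def
proof (intro conjI ballI)
  fix v
  assume "v \<in> Y"
  then have "(f has_derivative (\<lambda>h. inner h (gx (u, v), gy (u, v)))) (at (u, v) within X \<times> Y)"
    using f u by (simp add: smooth_with_partial_gradients_def smooth_with_gradient_def)
  then have "(f \<circ> (\<lambda>v. (u, v)) has_derivative
      (\<lambda>h. inner h (gx (u, v), gy (u, v))) \<circ> (\<lambda>h. (0, h))) (at v within Y)"
    using u by (intro diff_chain_within)
      (auto intro!: has_derivative_Pair has_derivative_ident has_derivative_const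
        elim: has_derivative_subset)
  then show "((\<lambda>v. f (u, v)) has_derivative (\<lambda>h. inner h (gy (u, v)))) (at v within Y)"
    by (simp add: o_def inner_Pair)
next
  have "continuous_on (X \<times> Y) (\<lambda>z. snd (gx z, gy z))"
    using f unfolding smooth_with_partial_gradients_def smooth_with_gradient_def
    by (intro continuous_on_snd) auto
  then show "continuous_on Y (\<lambda>v. gy (u, v))"
    using u by (intro continuous_on_compose2[of "X \<times> Y" gy Y "\<lambda>v. (u, v)"])
      (auto intro!: continuous_intros)
qed

section \<open>The estimate for consecutive iterates\<close>

theorem lemma4p3:
  fixes X :: "(real ^ 'n) set" and Y :: "(real ^ 'm) set"
    and f :: "(real ^ 'n) \<times> (real ^ 'm) \<Rightarrow> real"
    and gx :: "(real ^ 'n) \<times> (real ^ 'm) \<Rightarrow> real ^ 'n"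
    and gy :: "(real ^ 'n) \<times> (real ^ 'm) \<Rightarrow> real ^ 'm"
    and L11 L12 L21 L22 L11' \<zeta> \<nu> :: real
    and q \<gamma> :: "nat \<Rightarrow> real"
    and x :: "nat \<Rightarrow> real ^ 'n" and y :: "nat \<Rightarrow> real ^ 'm"
  assumes X: "X \<noteq> {}" "closed X" "bounded X" "convex X"
    and Y: "Y \<noteq> {}" "closed Y" "bounded Y" "convex Y"
    and smooth: "smooth_with_partial_gradients f gx gy X Y"
    and L_pos: "L11 > 0" "L12 > 0" "L21 > 0" "L22 > 0"
    and lipschitz: "lipschitz_gradients gx gy X Y L11 L12 L21 L22"
    and f_convex: "\<And>v. v \<in> Y \<Longrightarrow> convex_on X (\<lambda>u. f (u, v))"
    and q_nonneg: "\<And>k. k \<ge> 1 \<Longrightarrow> q k \<ge> 0"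
    and q_decreasing: "antimono_on {1..} q"
    and \<zeta>_pos: "\<zeta> > 0" and \<nu>_pos: "\<nu> > 0"
    and init: "x 1 \<in> X" "y 1 \<in> Y"
    and x_step: "\<And>k. k \<ge> 1 \<Longrightarrow>
      x (k + 1) = closest_point X (x k - \<zeta> *\<^sub>R gx (x k, y k) - (\<zeta> * q k) *\<^sub>R x k)"
    and y_step: "\<And>k. k \<ge> 1 \<Longrightarrow>
      y (k + 1) = closest_point Y (y k + (1 / (\<nu> + \<gamma> k)) *\<^sub>R gy (x (k + 1), y k))"
    and L11': "L11' = L11 + q 1"
    and \<gamma>_gt: "\<And>k. k \<ge> 1 \<Longrightarrow> \<gamma> k > L22"
    and \<zeta>_le: "\<zeta> \<le> 2 / (L11' + q 1)"
  shows "\<forall>k\<ge>2. f (x (k + 1), y (k + 1)) - f (x k, y k) \<ge>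
      (\<nu> + \<gamma> k / 2) * (norm (y (k + 1) - y k))\<^sup>2
      - L21\<^sup>2 * \<zeta> / 2 * (norm (y k - y (k - 1)))\<^sup>2
      - 1 / \<zeta> * (norm (x (k + 1) - x k))\<^sup>2
      - 1 / (2 * \<zeta>) * (norm (x k - x (k - 1)))\<^sup>2
      - q (k - 1) / 2 * ((norm (x (k + 1)))\<^sup>2 - (norm (x k))\<^sup>2)"
proof (intro allI impI)
  fix k :: nat
  assume "k \<ge> 2"
  \<comment> \<open>The argument uses the projection that produced \<open>x k\<close>, so
    \<open>k - 1\<close> must itself be an index of the iteration.\<close>
  then obtain j where j: "k = j + 1" "j \<ge> 1"
    by (metis add.commute add_leD2 le_add_diff_inverse nat_add_left_cancel_le one_add_one)
  have x_mem: "x i \<in> X" and y_mem: "y i \<in> Y" if "i \<ge> 1" for i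
    using that init x_step[of "i - 1"] y_step[of "i - 1"] X Y
    by (cases "i = 1"; simp add: closest_point_in_set)+
  define a b c where "a = x j" and "b = x k" and "c = x (k + 1)"
  define u v w where "u = y j" and "v = y k" and "w = y (k + 1)"
  note defs = a_def b_def c_def u_def v_def w_def
  have mem: "a \<in> X" "b \<in> X" "c \<in> X" "u \<in> Y" "v \<in> Y" "w \<in> Y"
    using x_mem y_mem j by (auto simp: defs)
  note smooth_x = smooth_with_partial_gradients_fst[OF smooth]
  note smooth_y = smooth_with_partial_gradients_snd[OF smooth]
  have lip_x: "L11-lipschitz_on X (\<lambda>s. gx (s, t))" if "t \<in> Y" for t
    using lipschitz that L_pos by (auto simp: lipschitz_gradients_def lipschitz_on_def dist_norm)
  have lip_y: "L22-lipschitz_on Y (\<lambda>t. gy (s, t))" if "s \<in> X" for s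
    using lipschitz that L_pos by (auto simp: lipschitz_gradients_def lipschitz_on_def dist_norm)

  have \<nu>\<gamma>: "\<nu> + \<gamma> k > 0"
    using \<nu>_pos \<gamma>_gt[of k] L_pos j by simp
  \<comment> \<open>The projection inequality for \<open>w\<close>, tested at the old iterate
    \<open>v\<close>.\<close>
  have "inner (v + (1 / (\<nu> + \<gamma> k)) *\<^sub>R gy (c, v) - w) (v - w) \<le> 0"
    using closest_point_dot[OF Y(4,2), of v] mem y_step[of k] j by (simp add: defs)
  then have "(\<nu> + \<gamma> k) * ((1 / (\<nu> + \<gamma> k)) * inner (gy (c, v)) (w - v)) \<ge> (\<nu> + \<gamma> k) * (norm (w - v))\<^sup>2"
    using \<nu>\<gamma> by (intro mult_left_mono)
      (simp_all add: power2_norm_eq_inner inner_commute[of _ "gy (c, v)"] inner_commute[of v w]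
        inner_diff_left inner_diff_right inner_add_left diff_divide_distrib)
  then have "inner (gy (c, v)) (w - v) \<ge> (\<nu> + \<gamma> k) * (norm (w - v))\<^sup>2"
    using \<nu>\<gamma> by simp
  \<comment> \<open>The descent lemma costs \<open>L22 / 2\<close>; paying
    \<open>\<gamma> k / 2\<close> instead turns \<open>\<nu> + \<gamma> k\<close> into
    \<open>\<nu> + \<gamma> k / 2\<close>.\<close>
  moreover have "L22 / 2 * (norm (w - v))\<^sup>2 \<le> \<gamma> k / 2 * (norm (w - v))\<^sup>2"
    using \<gamma>_gt[of k] j by (intro mult_right_mono) auto
  ultimately have y_part: "f (c, w) - f (c, v) \<ge> (\<nu> + \<gamma> k / 2) * (norm (w - v))\<^sup>2"
    using descent_lower[OF smooth_y[of c] Y(4) lip_y[of c], of v w] mem by (simp add: algebra_simps)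

  define d e Q where "d = c - b" and "e = b - a" and "Q = q j"
  have Q: "0 \<le> Q" "Q \<le> q 1"
    using q_nonneg[of j] monotone_onD[OF q_decreasing, of 1 j] j by (auto simp: Q_def)
  \<comment> \<open>The projection that produced \<open>b\<close>, tested at \<open>c\<close>,
    carries the previous weight \<open>q j\<close>; hence \<open>q (k - 1)\<close> in the
    conclusion.\<close>
  have "inner (a - \<zeta> *\<^sub>R gx (a, u) - (\<zeta> * Q) *\<^sub>R a - b) (c - b) \<le> 0"
    using closest_point_dot[OF X(4,2), of c] mem x_step[of j] j by (simp add: defs Q_def)
  then have "- inner e d \<le> \<zeta> * (inner (gx (a, u)) d + Q * inner a d)"
    by (simp add: d_def e_def inner_diff_left algebra_simps)
  then have proj: "- (inner e d / \<zeta>) \<le> inner (gx (a, u)) d + Q * inner a d"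
    using \<zeta>_pos by (simp only: minus_divide_left pos_divide_le_eq mult.commute)
  have tangent: "f (c, v) - f (b, v) \<ge> inner (gx (b, v)) d"
    using convex_above_tangent[OF smooth_x[of v] f_convex[of v], of b c] mem by (simp add: d_def)
  \<comment> \<open>The gradients in \<open>tangent\<close> and \<open>proj\<close> differ in both
    variables; their difference is split at \<open>gx (b, u)\<close>.\<close>
  have "norm (gx (b, v) - gx (b, u)) \<le> L21 * norm (v - u)"
    using lipschitz mem by (auto simp: lipschitz_gradients_def)
  then have "norm (gx (b, v) - gx (b, u)) * norm d \<le> L21 * norm (v - u) * norm d"
    by (intro mult_right_mono) auto
  \<comment> \<open>The weight \<open>\<zeta>\<close> in Young's inequality spends half of the final
    coefficient \<open>1 / \<zeta>\<close> of \<open>(norm d)\<^sup>2\<close>; the other half goes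
    to \<open>step\<close>.\<close>
  also have "\<dots> \<le> L21\<^sup>2 * \<zeta> / 2 * (norm (v - u))\<^sup>2 + 1 / (2 * \<zeta>) * (norm d)\<^sup>2"
    using \<zeta>_pos zero_le_power2[of "\<zeta> * (L21 * norm (v - u)) - norm d"]
    by (simp add: field_simps power2_eq_square)
  finally have cross: "inner (gx (b, v) - gx (b, u)) d \<ge>
      - (L21\<^sup>2 * \<zeta> / 2 * (norm (v - u))\<^sup>2) - 1 / (2 * \<zeta>) * (norm d)\<^sup>2"
    using Cauchy_Schwarz_ineq2[of "gx (b, v) - gx (b, u)" d] by linarith
  have three: "inner (gx (b, u) - gx (a, u)) d \<ge> - (L11 / 4 * (norm (d - e))\<^sup>2)"
    using gradient_difference_three_points[OF smooth_x[of u] f_convex[of u] lip_x[of u], of a b c] mem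
    by (simp add: d_def e_def)
  \<comment> \<open>Here \<open>L11' + q 1\<close> equals \<open>L11 + 2 * q 1\<close>. Half of
    \<open>1 / \<zeta>\<close> thus covers \<open>L11 / 4\<close> from \<open>three\<close> and also
    \<open>Q / 2\<close>, which creates the term \<open>Q * inner e d\<close> needed below.\<close>
  have "(L11 + 2 * q 1) / 2 \<le> 1 / \<zeta>"
    using \<zeta>_le \<zeta>_pos L_pos Q by (simp add: L11' field_simps)
  then have "L11 / 4 + Q / 2 \<le> 1 / (2 * \<zeta>)"
    using Q by simp
  then have "(L11 / 4 + Q / 2) * (norm (d - e))\<^sup>2 \<le> 1 / (2 * \<zeta>) * (norm (d - e))\<^sup>2"
    by (rule mult_right_mono) simp
  then have step: "L11 / 4 * (norm (d - e))\<^sup>2 \<le> 1 / (2 * \<zeta>) * (norm d)\<^sup>2 + 1 / (2 * \<zeta>) * (norm e)\<^sup>2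
      - inner e d / \<zeta> - Q / 2 * ((norm d)\<^sup>2 + (norm e)\<^sup>2) + Q * inner e d"
    by (simp add: power2_norm_eq_inner inner_diff_left inner_diff_right inner_commute algebra_simps
        add_divide_distrib diff_divide_distrib)
  \<comment> \<open>Since \<open>b = a + e\<close> and \<open>c = b + d\<close>, the terms with
    \<open>inner a d\<close> from \<open>proj\<close> and \<open>inner e d\<close> from
    \<open>step\<close> combine into the difference of squared norms.\<close>
  have "Q / 2 * ((norm c)\<^sup>2 - (norm b)\<^sup>2) = Q * inner a d + Q * inner e d + Q / 2 * (norm d)\<^sup>2"
    by (simp add: d_def e_def power2_norm_eq_inner inner_diff_left inner_diff_right inner_commute
        algebra_simps)
  moreover have "0 \<le> Q / 2 * (norm d)\<^sup>2" "0 \<le> Q / 2 * (norm e)\<^sup>2"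
    using Q by auto
  moreover have "1 / \<zeta> * (norm d)\<^sup>2 = 1 / (2 * \<zeta>) * (norm d)\<^sup>2 + 1 / (2 * \<zeta>) * (norm d)\<^sup>2"
    by simp
  ultimately have "f (c, v) - f (b, v) \<ge> - (L21\<^sup>2 * \<zeta> / 2 * (norm (v - u))\<^sup>2)
      - 1 / \<zeta> * (norm d)\<^sup>2 - 1 / (2 * \<zeta>) * (norm e)\<^sup>2 - Q / 2 * ((norm c)\<^sup>2 - (norm b)\<^sup>2)"
    using tangent proj cross three step
    by (simp only: inner_diff_left distrib_left)
  with y_part show "f (x (k + 1), y (k + 1)) - f (x k, y k) \<ge>
      (\<nu> + \<gamma> k / 2) * (norm (y (k + 1) - y k))\<^sup>2
      - L21\<^sup>2 * \<zeta> / 2 * (norm (y k - y (k - 1)))\<^sup>2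
      - 1 / \<zeta> * (norm (x (k + 1) - x k))\<^sup>2
      - 1 / (2 * \<zeta>) * (norm (x k - x (k - 1)))\<^sup>2
      - q (k - 1) / 2 * ((norm (x (k + 1)))\<^sup>2 - (norm (x k))\<^sup>2)"
    using j by (simp add: defs d_def e_def Q_def)
qed

end
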